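(* If $A\subseteq\mathbb{R}$ is nanoscopic and $B\subseteq\mathbb{R}$ is of strong measure zero, then $A\cup B$ is nanoscopic.
   Context: $\omega=\{0,1,2,\ldots\}$; $|J|$ denotes the length of an interval $J\subseteq\mathbb{R}$. A set $M\subseteq\mathbb{R}$ is called nanoscopic if for any $\varepsilon>0$ there exists a sequence of intervals $(I_k)_{k\in\omega}$ such that $M\subseteq\bigcup_k I_k$ and $|I_k|\le\varepsilon^{2^k}$ for all $k\in\omega$. A set $M\subseteq\mathbb{R}$ is of strong measure zero if for each sequence of positive reals $(\varepsilon_k)_{k\in\omega}$ there is a sequence of intervals $(I_k)_{k\in\omega}$ such that $M\subseteq\bigcup_k I_k$ and $|I_k|\le\varepsilon_k$ for all $k\in\omega$. *)

theory Defs
  imports "HOL-Analysis.Analysis"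
begin

text \<open>
  The length of an interval is expressed by its Lebesgue measure, taken in the extended
  nonnegative reals: an unbounded interval has length infinity and so never satisfies the
  bounds below. The real-valued \<^const>\<open>measure\<close> would give it length 0.
\<close>

definition nanoscopic :: "real set \<Rightarrow> bool" where
  "nanoscopic M \<longleftrightarrow>
    (\<forall>\<epsilon>>0. \<exists>I :: nat \<Rightarrow> real set.
      (\<forall>k. is_interval (I k)) \<and> M \<subseteq> (\<Union>k. I k) \<and>
      (\<forall>k. emeasure lborel (I k) \<le> ennreal (\<epsilon> ^ (2 ^ k))))"

definition strong_measure_zero :: "real set \<Rightarrow> bool" where
  "strong_measure_zero M \<longleftrightarrow>
    (\<forall>e :: nat \<Rightarrow> real. (\<forall>k. e k > 0) \<longrightarrow>
      (\<exists>I :: nat \<Rightarrow> real set.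
        (\<forall>k. is_interval (I k)) \<and> M \<subseteq> (\<Union>k. I k) \<and>
        (\<forall>k. emeasure lborel (I k) \<le> ennreal (e k))))"

end

theory Submission
  imports Defs
begin

text \<open>
  Call the index k the slot for intervals of length at most \<open>\<epsilon> ^ 2 ^ k\<close>. It suffices to cover A
  while leaving infinitely many slots unused, since B fits into any infinite set of slots.
  Covers of A for \<open>\<epsilon> ^ 2 ^ n\<close> use only the slots from n on. If, for some positive n, infinitely
  many intervals of such a cover meet a bounded set, then they accumulate at a point; a single
  interval around that point, put into slot 0, makes infinitely many of them superfluous.
  Otherwise all these covers are locally finite. Then every bounded part of A is covered by
  finitely many slots beyond any given one, so A can be exhausted by bounded parts using
  consecutive finite blocks of slots, skipping one slot after each block.
\<close>

text \<open>Turns a bound on measure into a bound on distance: the segment between two points of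
  \<open>I\<close> lies in \<open>I\<close>, so its measure is at most that of
  \<open>I\<close>.\<close>

lemma interval_dist_le_length:
  fixes I :: "real set"
  assumes "is_interval I" "emeasure lborel I \<le> ennreal r" "0 \<le> r" "x \<in> I" "y \<in> I"
  shows "\<bar>x - y\<bar> \<le> r"
proof -
  have *: "y - x \<le> r" if "x \<in> I" "y \<in> I" "x \<le> y" for x y
  proof -
    have "{x..y} \<subseteq> I"
      using mem_is_interval_1_I[OF assms(1) that(1,2)] by auto
    moreover have "I \<in> sets lborel"
      using assms(1) real_interval_borel_measurable by simp
    ultimately have "emeasure lborel {x..y} \<le> emeasure lborel I"
      by (rule emeasure_mono)
    also note assms(2)
    finally show ?thesis
      using that(3) assms(3) by simp
  qed
  show ?thesis
    using *[OF assms(4,5)] *[OF assms(5,4)] by linarith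
qed

lemma nanoscopic_shifted_cover:
  assumes "nanoscopic A" "0 < \<epsilon>"
  obtains I :: "nat \<Rightarrow> real set" where
    "\<And>k. is_interval (I k)" "A \<subseteq> (\<Union>k. I k)"
    "\<And>k. emeasure lborel (I k) \<le> ennreal (\<epsilon> ^ 2 ^ (n + k))"
proof -
  have "0 < \<epsilon> ^ 2 ^ n"
    using assms(2) by simp
  from assms(1)[unfolded nanoscopic_def, rule_format, OF this]
  obtain I :: "nat \<Rightarrow> real set" where "\<forall>k. is_interval (I k)" "A \<subseteq> (\<Union>k. I k)"
    "\<forall>k. emeasure lborel (I k) \<le> ennreal ((\<epsilon> ^ 2 ^ n) ^ 2 ^ k)"
    by blast
  moreover have "(\<epsilon> ^ 2 ^ n) ^ 2 ^ k = \<epsilon> ^ 2 ^ (n + k)" for k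
    by (simp only: power_mult power_add)
  ultimately show ?thesis
    by (intro that[of I]) simp_all
qed

text \<open>Bolzano-Weierstrass: pick a point of \<open>{-a..a}\<close> in each interval that meets
  this set. A subsequence of these points converges to some \<open>p\<close>, and as the lengths
  tend to 0, the intervals themselves end up near \<open>p\<close>.\<close>

lemma accumulating_intervals:
  fixes I :: "nat \<Rightarrow> real set"
  assumes int: "\<And>k. is_interval (I k)"
    and len: "\<And>k. emeasure lborel (I k) \<le> ennreal (r k)" "\<And>k. 0 \<le> r k" "r \<longlonglongrightarrow> 0"
    and inf: "infinite {k. I k \<inter> {-a..a} \<noteq> {}}"
    and "0 < d"
  obtains p where "infinite {k. I k \<subseteq> {p - d..p + d}}"
proof -
  define T where "T = {k. I k \<inter> {-a..a} \<noteq> {}}"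
  define x where "x j = (SOME x. x \<in> I (enumerate T j) \<inter> {-a..a})" for j
  have T: "infinite T"
    using inf by (simp add: T_def)
  have x: "x j \<in> I (enumerate T j) \<inter> {-a..a}" for j
  proof -
    have "enumerate T j \<in> {k. I k \<inter> {-a..a} \<noteq> {}}"
      using enumerate_in_set[OF T] by (simp only: T_def)
    then have "\<exists>x. x \<in> I (enumerate T j) \<inter> {-a..a}"
      by blast
    then show ?thesis
      unfolding x_def by (rule someI_ex)
  qed
  have "seq_compact {-a..a}"
    by (simp add: compact_imp_seq_compact)
  moreover have "\<forall>j. x j \<in> {-a..a}"
    using x by blast
  ultimately obtain p \<phi> where \<phi>: "strict_mono \<phi>" "(x \<circ> \<phi>) \<longlonglongrightarrow> p"
    by (meson seq_compactE)
  define \<psi> where "\<psi> = enumerate T \<circ> \<phi>"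
  have \<psi>: "strict_mono \<psi>"
    unfolding \<psi>_def using strict_mono_enumerate[OF T] \<phi>(1) by (rule strict_mono_o)
  have "(\<lambda>i. r (\<psi> i)) \<longlonglongrightarrow> 0"
    using LIMSEQ_subseq_LIMSEQ[OF len(3) \<psi>] by (simp add: o_def)
  then have "eventually (\<lambda>i. r (\<psi> i) < d / 2) sequentially"
    using \<open>0 < d\<close> by (intro order_tendstoD) auto
  moreover have "eventually (\<lambda>i. dist ((x \<circ> \<phi>) i) p < d / 2) sequentially"
    using tendstoD[OF \<phi>(2), of "d / 2"] \<open>0 < d\<close> by simp
  \<comment> \<open>Half of \<open>d\<close> pays for the distance from the chosen point to
    \<open>p\<close>, the other half for the length of the interval.\<close>
  ultimately have "eventually (\<lambda>i. I (\<psi> i) \<subseteq> {p - d..p + d}) sequentially"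
  proof eventually_elim
    case (elim i)
    show ?case
    proof
      fix y assume y: "y \<in> I (\<psi> i)"
      have "\<bar>y - x (\<phi> i)\<bar> \<le> r (\<psi> i)"
        using interval_dist_le_length[OF int len(1) len(2) y] x[of "\<phi> i"]
        by (simp add: \<psi>_def)
      moreover have "\<bar>x (\<phi> i) - p\<bar> < d / 2"
        using elim(2) by (simp add: dist_real_def)
      ultimately have "\<bar>y - p\<bar> \<le> d"
        using elim(1) by linarith
      then show "y \<in> {p - d..p + d}"
        by (simp add: abs_le_iff)
    qed
  qed
  then obtain N where N: "\<And>i. i \<ge> N \<Longrightarrow> I (\<psi> i) \<subseteq> {p - d..p + d}"
    by (auto simp: eventually_sequentially)
  have "infinite (\<psi> ` {N..})"
    using strict_mono_imp_inj_on[OF \<psi>]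
    by (subst finite_image_iff) (auto simp: infinite_Ici inj_on_subset)
  moreover have "\<psi> ` {N..} \<subseteq> {k. I k \<subseteq> {p - d..p + d}}"
    using N by auto
  ultimately show ?thesis
    using that infinite_super by blast
qed

lemma power_two_power_tendsto_0:
  fixes \<epsilon> :: real
  assumes "0 < \<epsilon>" "\<epsilon> < 1"
  shows "(\<lambda>k. \<epsilon> ^ 2 ^ (n + k)) \<longlonglongrightarrow> 0"
proof -
  have "strict_mono (\<lambda>k. 2 ^ (n + k) :: nat)"
    by (simp add: strict_mono_def)
  then show ?thesis
    using LIMSEQ_subseq_LIMSEQ[of "\<lambda>k. \<epsilon> ^ k" 0 "\<lambda>k. 2 ^ (n + k)"] LIMSEQ_realpow_zero[of \<epsilon>] assms
    by (simp add: o_def)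
qed

text \<open>\<open>S\<close> is the set of slots kept free for B. What \<open>I\<close> holds on
  \<open>S\<close> is immaterial, since only the slots outside \<open>S\<close> have to cover
  \<open>A\<close>.\<close>

definition gap_cover :: "real \<Rightarrow> real set \<Rightarrow> bool" where
  "gap_cover \<epsilon> A \<longleftrightarrow> (\<exists>S I. infinite S \<and> A \<subseteq> (\<Union>k\<in>-S. I k) \<and>
    (\<forall>k. is_interval (I k) \<and> emeasure lborel (I k) \<le> ennreal (\<epsilon> ^ 2 ^ k)))"

lemma gap_cover_accumulating:
  fixes C :: "nat \<Rightarrow> real set"
  assumes \<epsilon>: "0 < \<epsilon>" "\<epsilon> < 1" and "0 < n"
    and C: "\<And>k. is_interval (C k)" "A \<subseteq> (\<Union>k. C k)"
      "\<And>k. emeasure lborel (C k) \<le> ennreal (\<epsilon> ^ 2 ^ (n + k))"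
    and inf: "infinite {k. C k \<inter> {-a..a} \<noteq> {}}"
  shows "gap_cover \<epsilon> A"
proof -
  \<comment> \<open>Radius \<open>\<epsilon> / 2\<close> gives the interval around \<open>p\<close>
    length \<open>\<epsilon>\<close>, the bound of slot 0. As \<open>0 < n\<close>, no
    \<open>C k\<close> occupies that slot.\<close>
  obtain p where p: "infinite {k. C k \<subseteq> {p - \<epsilon> / 2..p + \<epsilon> / 2}}"
    using accumulating_intervals[OF C(1) C(3) _ power_two_power_tendsto_0[OF \<epsilon>] inf, of "\<epsilon> / 2"] \<epsilon>
    by auto
  define S where "S = (+) n ` {k. C k \<subseteq> {p - \<epsilon> / 2..p + \<epsilon> / 2}}"
  define I where
    "I i = (if i = 0 then {p - \<epsilon> / 2..p + \<epsilon> / 2} else if n \<le> i then C (i - n) else {})" for i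
  have "infinite S"
    unfolding S_def using p by (subst finite_image_iff) auto
  moreover have "A \<subseteq> (\<Union>k\<in>-S. I k)"
  proof
    fix x assume "x \<in> A"
    then obtain k where k: "x \<in> C k"
      using C(2) by auto
    show "x \<in> (\<Union>k\<in>-S. I k)"
    proof (cases "C k \<subseteq> {p - \<epsilon> / 2..p + \<epsilon> / 2}")
      case True
      then have "x \<in> I 0" "0 \<notin> S"
        using k \<open>0 < n\<close> by (auto simp: I_def S_def)
      then show ?thesis by blast
    next
      case False
      then have "x \<in> I (n + k)" "n + k \<notin> S"
        using k \<open>0 < n\<close> by (auto simp: I_def S_def)
      then show ?thesis by blast
    qed
  qed
  moreover have "is_interval (I i)" for i
    using C(1) by (auto simp: I_def is_interval_cc)
  moreover have "emeasure lborel (I i) \<le> ennreal (\<epsilon> ^ 2 ^ i)" for i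
    using C(3)[of "i - n"] \<epsilon> by (auto simp: I_def)
  ultimately show ?thesis
    unfolding gap_cover_def by blast
qed

lemma gap_cover_locally_finite:
  fixes C :: "nat \<Rightarrow> nat \<Rightarrow> real set"
  assumes C: "\<And>n k. is_interval (C n k)" "\<And>n. 0 < n \<Longrightarrow> A \<subseteq> (\<Union>k. C n k)"
      "\<And>n k. emeasure lborel (C n k) \<le> ennreal (\<epsilon> ^ 2 ^ (n + k))"
    and fin: "\<And>n a. 0 < n \<Longrightarrow> finite {k. C n k \<inter> {-a..a} \<noteq> {}}"
  shows "gap_cover \<epsilon> A"
proof -
  have "\<exists>K. \<forall>k\<ge>K. C n k \<inter> {-real m..real m} = {}" if "0 < n" for n m
    using fin[OF that, of "real m"] unfolding finite_nat_set_iff_bounded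
    by (auto simp: not_less[symmetric])
  then obtain K where K: "\<And>n m k. \<lbrakk>0 < n; K n m \<le> k\<rbrakk> \<Longrightarrow> C n k \<inter> {-real m..real m} = {}"
    by metis
  \<comment> \<open>Block \<open>j\<close> starts at slot \<open>s j\<close> and holds the first
    \<open>K (s j) j\<close> intervals of \<open>C (s j)\<close>; they cover the part of
    \<open>A\<close> in \<open>{-real j..real j}\<close>. The slot \<open>s j + K (s j) j\<close> is
    the gap after it. Starting from 1 keeps every \<open>s j\<close> positive, as \<open>K\<close>
    requires.\<close>
  define s where "s = rec_nat 1 (\<lambda>j t. Suc (t + K t j))"
  have s_Suc: "s (Suc j) = Suc (s j + K (s j) j)" for j
    by (simp add: s_def)
  have mono: "strict_mono s"
    by (simp add: strict_mono_Suc_iff s_Suc)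
  have pos: "0 < s j" for j
    by (cases j) (auto simp: s_def)
  define blk where "blk i = (LEAST j. i < s (Suc j))" for i
  have blk: "blk i = j" if "s j \<le> i" "i < s (Suc j)" for i j
    unfolding blk_def
  proof (rule Least_equality)
    fix j' assume "i < s (Suc j')"
    then have "s j < s (Suc j')"
      using that(1) by simp
    then show "j \<le> j'"
      using mono by (simp add: strict_mono_less)
  qed (use that in simp)
  \<comment> \<open>The shift by \<open>s (blk i)\<close> makes the bound for \<open>C\<close>
    exactly that of slot \<open>i\<close>. The empty set arises only for slot 0, which precedes the
    first block.\<close>
  define I where "I i = (if s (blk i) \<le> i then C (s (blk i)) (i - s (blk i)) else {})" for i
  define S where "S = range (\<lambda>j. s j + K (s j) j)"
  have "strict_mono (\<lambda>j. s j + K (s j) j)"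
  proof (rule strict_mono_Suc_iff[THEN iffD2], rule allI)
    show "s j + K (s j) j < s (Suc j) + K (s (Suc j)) (Suc j)" for j
      using s_Suc[of j] by linarith
  qed
  then have "infinite S"
    unfolding S_def by (intro range_inj_infinite strict_mono_imp_inj_on)
  moreover have "A \<subseteq> (\<Union>k\<in>-S. I k)"
  proof
    fix x assume "x \<in> A"
    obtain j :: nat where j: "\<bar>x\<bar> \<le> real j"
      using real_arch_simple by blast
    obtain k where k: "x \<in> C (s j) k"
      using C(2)[OF pos] \<open>x \<in> A\<close> by blast
    have "x \<in> C (s j) k \<inter> {-real j..real j}"
      using j k by auto
    then have "k < K (s j) j"
      using K[OF pos] by (metis empty_iff not_less)
    then have bnd: "s j + k < s j + K (s j) j"
      by simp
    then have b: "blk (s j + k) = j"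
      by (intro blk) (auto simp: s_Suc)
    \<comment> \<open>A gap slot determines its block. Here the block would be \<open>j\<close>,
      whose only gap lies above \<open>s j + k\<close>.\<close>
    have "s j + k \<notin> S"
    proof
      assume "s j + k \<in> S"
      then obtain j' where j': "s j + k = s j' + K (s j') j'"
        by (auto simp: S_def)
      then have "blk (s j + k) = j'"
        by (intro blk) (auto simp: s_Suc)
      then show False
        using b bnd j' by simp
    qed
    moreover have "x \<in> I (s j + k)"
      using k by (simp add: I_def b)
    ultimately show "x \<in> (\<Union>k\<in>-S. I k)"
      by blast
  qed
  moreover have "is_interval (I i)" for i
    using C(1) by (auto simp: I_def)
  moreover have "emeasure lborel (I i) \<le> ennreal (\<epsilon> ^ 2 ^ i)" for i
    using C(3)[of "s (blk i)" "i - s (blk i)"] by (auto simp: I_def)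
  ultimately show ?thesis
    unfolding gap_cover_def by blast
qed

lemma nanoscopic_imp_gap_cover:
  assumes "nanoscopic A" "0 < \<epsilon>" "\<epsilon> < 1"
  shows "gap_cover \<epsilon> A"
proof -
  have "\<forall>n. \<exists>I :: nat \<Rightarrow> real set. (\<forall>k. is_interval (I k)) \<and> A \<subseteq> (\<Union>k. I k) \<and>
      (\<forall>k. emeasure lborel (I k) \<le> ennreal (\<epsilon> ^ 2 ^ (n + k)))"
    by (metis nanoscopic_shifted_cover[OF assms(1,2)])
  then obtain C :: "nat \<Rightarrow> nat \<Rightarrow> real set" where
    C: "\<And>n k. is_interval (C n k)" "\<And>n. A \<subseteq> (\<Union>k. C n k)"
      "\<And>n k. emeasure lborel (C n k) \<le> ennreal (\<epsilon> ^ 2 ^ (n + k))"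
    by metis
  show ?thesis
  \<comment> \<open>Only positive \<open>n\<close> are examined: an accumulating cover must leave
    slot 0 vacant, and the block construction uses no cover with \<open>n = 0\<close>.\<close>
  proof (cases "\<exists>n a. 0 < n \<and> infinite {k. C n k \<inter> {-a..a} \<noteq> {}}")
    case True
    then show ?thesis
      using gap_cover_accumulating[OF assms(2,3) _ C] by blast
  next
    case False
    then show ?thesis
      using gap_cover_locally_finite[OF C] by blast
  qed
qed

text \<open>The bounds of the free slots, listed by \<open>enumerate S\<close>, form a sequence of
  positive reals to which strong measure zero applies; the \<open>k\<close>-th interval obtained for
  \<open>B\<close> goes into slot \<open>enumerate S k\<close>.\<close>

lemma gap_cover_Un_strong_measure_zero:
  assumes "gap_cover \<epsilon> A" "strong_measure_zero B" "0 < \<epsilon>"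
  shows "\<exists>I :: nat \<Rightarrow> real set. (\<forall>k. is_interval (I k)) \<and> A \<union> B \<subseteq> (\<Union>k. I k) \<and>
    (\<forall>k. emeasure lborel (I k) \<le> ennreal (\<epsilon> ^ 2 ^ k))"
proof -
  obtain S and I :: "nat \<Rightarrow> real set" where S: "infinite S" and A: "A \<subseteq> (\<Union>k\<in>-S. I k)"
    and I: "\<And>k. is_interval (I k)" "\<And>k. emeasure lborel (I k) \<le> ennreal (\<epsilon> ^ 2 ^ k)"
    using assms(1) unfolding gap_cover_def by blast
  have "\<forall>k. 0 < \<epsilon> ^ 2 ^ enumerate S k"
    using assms(3) by simp
  then obtain H :: "nat \<Rightarrow> real set" where H: "\<And>k. is_interval (H k)" "B \<subseteq> (\<Union>k. H k)"
    "\<And>k. emeasure lborel (H k) \<le> ennreal (\<epsilon> ^ 2 ^ enumerate S k)"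
    using assms(2)[unfolded strong_measure_zero_def, rule_format, of "\<lambda>k. \<epsilon> ^ 2 ^ enumerate S k"]
    by blast
  define L where "L i = (if i \<in> S then H (inv (enumerate S) i) else I i)" for i
  have L_enum: "L (enumerate S k) = H k" for k
    using S by (simp add: L_def enumerate_in_set inv_f_f strict_mono_imp_inj_on strict_mono_enumerate)
  have "is_interval (L i)" for i
    using H(1) I(1) by (simp add: L_def)
  moreover have "A \<subseteq> (\<Union>k. L k)"
    using A by (force simp: L_def)
  moreover have "B \<subseteq> (\<Union>k. L k)"
    using H(2) L_enum by blast
  moreover have "emeasure lborel (L i) \<le> ennreal (\<epsilon> ^ 2 ^ i)" for i
  proof (cases "i \<in> S")
    case True
    then obtain k where "i = enumerate S k"
      using range_enumerate[OF S] by blast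
    then show ?thesis
      using H(3)[of k] by (simp add: L_enum)
  next
    case False
    then show ?thesis
      using I(2) by (simp add: L_def)
  qed
  ultimately show ?thesis
    by (intro exI[of _ L]) auto
qed

theorem theorem3p2:
  fixes A B :: "real set"
  assumes "nanoscopic A" and "strong_measure_zero B"
  shows "nanoscopic (A \<union> B)"
  unfolding nanoscopic_def
proof (intro allI impI)
  fix \<epsilon> :: real assume "0 < \<epsilon>"
  \<comment> \<open>A bound below 1 makes the slot lengths tend to 0, which the accumulation
    argument needs; a cover for the smaller \<open>\<delta>\<close> also serves for
    \<open>\<epsilon>\<close>.\<close>
  define \<delta> where "\<delta> = min \<epsilon> (1 / 2)"
  have \<delta>: "0 < \<delta>" "\<delta> < 1" "\<delta> \<le> \<epsilon>"
    using \<open>0 < \<epsilon>\<close> by (auto simp: \<delta>_def)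
  have "ennreal (\<delta> ^ 2 ^ k) \<le> ennreal (\<epsilon> ^ 2 ^ k)" for k
    using \<delta> by (intro ennreal_leI power_mono) auto
  then show "\<exists>I :: nat \<Rightarrow> real set. (\<forall>k. is_interval (I k)) \<and> A \<union> B \<subseteq> (\<Union>k. I k) \<and>
      (\<forall>k. emeasure lborel (I k) \<le> ennreal (\<epsilon> ^ 2 ^ k))"
    using gap_cover_Un_strong_measure_zero[OF nanoscopic_imp_gap_cover[OF assms(1) \<delta>(1,2)] assms(2) \<delta>(1)]
    by (meson order_trans)
qed

end
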